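(* Let $p$ be a prime, $K$ an F-finite field of characteristic $p$, $S=K[x,y,z]$ and $I=(x^2y^2,\,y^3z^3)$. Then: (a) If $p=2$, then $I^{[t]}=S$ for $t\in[0,\frac12)$, $I^{[t]}=(xy,yz)$ for $t\in[\frac12,\frac34)$, and $I^{[t]}=(xy,y^2z)$ for $t\in[\frac34,1)$. (b) If $p=3$, then $I^{[t]}=S$ for $t\in[0,\frac12)$, $I^{[t]}=(y)$ for $t\in[\frac12,\frac23)$, $I^{[t]}=(xy,yz)$ for $t\in[\frac23,\frac56)$, and $I^{[t]}=(xy,y^2z)$ for $t\in[\frac56,1)$. (c) If $p\equiv 1\pmod 3$, then $I^{[t]}=S$ for $t\in[0,\frac12)$, $I^{[t]}=(y)$ for $t\in[\frac12,\frac56)$, and $I^{[t]}=(xy,y^2z)$ for $t\in[\frac56,1)$. (d) If $p\equiv 2\pmod 3$ and $p\neq 2$, then $I^{[t]}=S$ for $t\in[0,\frac12)$, $I^{[t]}=(y)$ for $t\in[\frac12,\frac{5p-1}{6p})$, and $I^{[t]}=(xy,y^2z)$ for $t\in[\frac{5p-1}{6p},1)$.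
   Context: $K$ is F-finite if it is finitely generated over $K^p$. $q$ always denotes a power $p^e$, $e\ge 0$. For an ideal $J\subseteq S$, $J^{[q]}=(f^q\mid f\in J)$ and $J^{[1/q]}$ is the smallest ideal $L$ with $L^{[q]}\supseteq J$. For an integer $k\ge 0$ with base $p$ expansion $k=k_0+k_1p+\cdots+k_rp^r$, $I^{[k]}=I^{k_0}(I^{k_1})^{[p]}\cdots(I^{k_r})^{[p^r]}$. Put $I^{[k/q]}=(I^{[k]})^{[1/q]}$. For real $t\ge 0$, $I^{[t]}$ is the stable value of the ascending chain $I^{[t_1]}\subseteq I^{[t_2]}\subseteq\cdots$ for any monotone decreasing sequence $(t_j)$ of rationals of the form $k/q$ converging to $t$ from above. *)

theory Defs
  imports
    "HOL-Analysis.Analysis"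
    "HOL-Library.Poly_Mapping"
    "HOL-Library.Log_Nat"
    "HOL-Computational_Algebra.Computational_Algebra"
begin

text \<open>
  Finitely generated as a module over the subfield \<open>K\<^sup>p\<close>, whose elements are exactly
  the powers \<open>c ^ p\<close>.
\<close>

definition F_finite :: "'k::field itself \<Rightarrow> bool" where
  "F_finite _ \<longleftrightarrow>
     (\<exists>B :: 'k set. finite B \<and>
        (\<forall>a. \<exists>c :: 'k \<Rightarrow> 'k. a = (\<Sum>b\<in>B. c b ^ CHAR('k) * b)))"

text \<open>Ideals are the submodules of the ring regarded as a module over itself.\<close>

interpretation ideal: module "(*) :: 'a::comm_ring_1 \<Rightarrow> 'a \<Rightarrow> 'a"
  by standard (simp_all add: algebra_simps)

abbreviation is_ideal :: "'a::comm_ring_1 set \<Rightarrow> bool" where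
  "is_ideal \<equiv> module.subspace (*)"

abbreviation ideal_gen :: "'a::comm_ring_1 set \<Rightarrow> 'a set" where
  "ideal_gen \<equiv> module.span (*)"

definition ideal_mult :: "'a::comm_ring_1 set \<Rightarrow> 'a set \<Rightarrow> 'a set" where
  "ideal_mult I J = ideal_gen {a * b | a b. a \<in> I \<and> b \<in> J}"

primrec ideal_pow :: "'a::comm_ring_1 set \<Rightarrow> nat \<Rightarrow> 'a set" where
  "ideal_pow I 0 = UNIV"
| "ideal_pow I (Suc n) = ideal_mult I (ideal_pow I n)"

text \<open>\<open>J\<^bsup>[q]\<^esup>\<close> and \<open>J\<^bsup>[1/q]\<^esup>\<close>, intended for \<open>q\<close> a power of the characteristic \<open>p\<close>.\<close>

definition frob_power :: "nat \<Rightarrow> 'a::comm_ring_1 set \<Rightarrow> 'a set" where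
  "frob_power q J = ideal_gen {f ^ q | f. f \<in> J}"

definition frob_root :: "nat \<Rightarrow> 'a::comm_ring_1 set \<Rightarrow> 'a set" where
  "frob_root q J = (LEAST L. is_ideal L \<and> J \<subseteq> frob_power q L)"

text \<open>
  \<open>I\<^bsup>[k]\<^esup>\<close>: \<open>floorlog p k\<close> is the number of base \<open>p\<close> digits of \<open>k\<close>
  and \<open>k div p ^ i mod p\<close> is the \<open>i\<close>-th digit. The empty product of ideals is the whole ring.
\<close>

definition gen_frob_power_nat :: "nat \<Rightarrow> 'a::comm_ring_1 set \<Rightarrow> nat \<Rightarrow> 'a set" where
  "gen_frob_power_nat p I k =
     foldr ideal_mult
       (map (\<lambda>i. frob_power (p ^ i) (ideal_pow I (k div p ^ i mod p))) [0..<floorlog p k])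
       UNIV"

text \<open>\<open>I\<^bsup>[k/q]\<^esup>\<close> for \<open>q = p ^ e\<close>.\<close>

definition gen_frob_power_rat :: "nat \<Rightarrow> 'a::comm_ring_1 set \<Rightarrow> nat \<Rightarrow> nat \<Rightarrow> 'a set" where
  "gen_frob_power_rat p I k e = frob_root (p ^ e) (gen_frob_power_nat p I k)"

text \<open>
  \<open>I\<^bsup>[t]\<^esup>\<close> for real \<open>t \<ge> 0\<close>: the common stable value over all monotone decreasing
  sequences \<open>k j / p ^ e j\<close> converging to \<open>t\<close>. Monotonicity forces all terms to be \<open>\<ge> t\<close>;
  the constant sequence is allowed.
\<close>

definition gen_frob_power :: "nat \<Rightarrow> 'a::comm_ring_1 set \<Rightarrow> real \<Rightarrow> 'a set" where
  "gen_frob_power p I t =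
     (THE L. \<forall>k e :: nat \<Rightarrow> nat.
        decseq (\<lambda>j. real (k j) / real (p ^ e j)) \<longrightarrow>
        (\<lambda>j. real (k j) / real (p ^ e j)) \<longlonglongrightarrow> t \<longrightarrow>
        (\<forall>\<^sub>F j in sequentially. gen_frob_power_rat p I (k j) (e j) = L))"

datatype xyz = X | Y | Z

text \<open>Finitely supported maps from exponent vectors to coefficients.\<close>

type_synonym 'k poly3 = "(xyz \<Rightarrow>\<^sub>0 nat) \<Rightarrow>\<^sub>0 'k"

definition Var :: "xyz \<Rightarrow> 'k::field poly3" where
  "Var v = Poly_Mapping.single (Poly_Mapping.single v 1) 1"

end

theory Submission
  imports Defs
begin

text \<open>
  Put \<open>u = x\<^sup>2y\<^sup>2\<close> and \<open>v = y\<^sup>3z\<^sup>3\<close>. Then \<open>I\<^bsup>[k]\<^esup>\<close> is generated by the \<open>u\<^sup>iv\<^sup>j\<close> for which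
  \<open>i + j = k\<close> without carries in base \<open>p\<close>, and taking the \<open>q\<close>-th Frobenius root of a monomial ideal
  divides all exponents by \<open>q\<close>, rounding down. So \<open>I\<^bsup>[k/q]\<^esup>\<close> is generated by the monomials with exponents
  \<open>\<lfloor>2i/q\<rfloor>\<close>, \<open>\<lfloor>(2i+3j)/q\<rfloor>\<close>, \<open>\<lfloor>3j/q\<rfloor>\<close>, and which of them occur depends only on how far the leading
  digits of \<open>k\<close> can be distributed over \<open>i < q/2\<close> and \<open>j < q/3\<close> or \<open>j < 2q/3\<close>.
\<close>

text \<open>As a simplification rule for \<open>(*)\<close>, this would loop with \<open>mult.assoc\<close>.\<close>

declare ideal.scale_scale [simp del]

subsection \<open>Frobenius powers of finitely generated ideals\<close>

text \<open>Mutual divisibility puts each generating set inside the other span. For monomial ideals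
  this turns an equality of ideals into inequalities between exponents.\<close>

lemma ideal_gen_eq_dvdI:
  fixes S T :: "'a::comm_ring_1 set"
  assumes "\<And>s. s \<in> S \<Longrightarrow> \<exists>t\<in>T. t dvd s" and "\<And>t. t \<in> T \<Longrightarrow> \<exists>s\<in>S. s dvd t"
  shows "ideal_gen S = ideal_gen T"
proof -
  have *: "A \<subseteq> ideal_gen B" if dvd: "\<And>a. a \<in> A \<Longrightarrow> \<exists>b\<in>B. b dvd a" for A B :: "'a set"
  proof
    fix a assume "a \<in> A"
    then obtain b where "b \<in> B" "b dvd a" using dvd by blast
    then obtain c where "a = c * b" by (metis dvd_def mult.commute)
    then show "a \<in> ideal_gen B"
      using \<open>b \<in> B\<close> by (simp add: ideal.span_base ideal.span_scale)
  qed
  show ?thesis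
    unfolding ideal.span_eq using assms *[of S T] *[of T S] by blast
qed

lemma ideal_gen_1: "ideal_gen {1 :: 'a::comm_ring_1} = UNIV"
  unfolding ideal.span_singleton by simp

lemma ideal_mult_gen:
  fixes S T :: "'a::comm_ring_1 set"
  shows "ideal_mult (ideal_gen S) (ideal_gen T) = ideal_gen {s * t | s t. s \<in> S \<and> t \<in> T}"
    (is "_ = ideal_gen ?ST")
proof -
  have 1: "s * b \<in> ideal_gen ?ST" if "s \<in> S" "b \<in> ideal_gen T" for s b
    using that(2)
  proof (induction rule: ideal.span_induct_alt)
    case (step c x y)
    have "c * (s * x) \<in> ideal_gen ?ST"
      using step that by (intro ideal.span_scale ideal.span_base) blast
    then have "c * (s * x) + s * y \<in> ideal_gen ?ST"
      using step(2) by (rule ideal.span_add)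
    then show ?case by (simp only: distrib_left mult.left_commute)
  qed (simp add: ideal.span_zero)
  have 2: "a * b \<in> ideal_gen ?ST" if "a \<in> ideal_gen S" "b \<in> ideal_gen T" for a b
    using that(1)
  proof (induction rule: ideal.span_induct_alt)
    case (step c x y)
    have "c * (x * b) + y * b \<in> ideal_gen ?ST"
      by (rule ideal.span_add[OF ideal.span_scale[OF 1[OF step(1) that(2)]] step(2)])
    then show ?case by (simp only: distrib_right mult.assoc)
  qed (simp add: ideal.span_zero)
  show ?thesis
    unfolding ideal_mult_def ideal.span_eq
  proof (intro conjI subsetI)
    fix f assume "f \<in> {a * b | a b. a \<in> ideal_gen S \<and> b \<in> ideal_gen T}"
    then show "f \<in> ideal_gen ?ST" using 2 by blast
  next
    fix f assume "f \<in> ?ST"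
    then have "f \<in> {a * b | a b. a \<in> ideal_gen S \<and> b \<in> ideal_gen T}"
      by (blast intro: ideal.span_base)
    then show "f \<in> ideal_gen {a * b | a b. a \<in> ideal_gen S \<and> b \<in> ideal_gen T}"
      by (rule ideal.span_base)
  qed
qed

text \<open>In characteristic p the map f -> f^q is additive. It sends a linear combination of
  generators to one of their q-th powers, the coefficients being raised to the q as well.\<close>

lemma frob_power_gen:
  fixes S :: "'a::comm_ring_1 set"
  assumes "prime CHAR('a)" "q = CHAR('a) ^ e"
  shows "frob_power q (ideal_gen S) = ideal_gen ((\<lambda>s. s ^ q) ` S)"
proof -
  have *: "f ^ q \<in> ideal_gen ((\<lambda>s. s ^ q) ` S)" if "f \<in> ideal_gen S" for f
    using that
  proof (induction rule: ideal.span_induct_alt)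
    case base
    have "q > 0" using assms by (simp add: prime_gt_0_nat)
    then show ?case by (simp add: ideal.span_zero power_0_left)
  next
    case (step c x y)
    have "c ^ q * x ^ q + y ^ q \<in> ideal_gen ((\<lambda>s. s ^ q) ` S)"
      by (rule ideal.span_add[OF ideal.span_scale[OF ideal.span_base]]) (use step in auto)
    then show ?case
      by (simp only: freshmans_dream'[OF assms] power_mult_distrib)
  qed
  show ?thesis
    unfolding frob_power_def ideal.span_eq
  proof (intro conjI subsetI)
    fix f assume "f \<in> (\<lambda>s. s ^ q) ` S"
    then obtain s where "s \<in> ideal_gen S" "f = s ^ q"
      using ideal.span_base by auto
    then show "f \<in> ideal_gen {f ^ q | f. f \<in> ideal_gen S}"
      by (intro ideal.span_base) auto
  qed (use * in auto)
qed

lemma ideal_pow_gen2: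
  "ideal_pow (ideal_gen {u, v :: 'a::comm_ring_1}) n = ideal_gen {u ^ i * v ^ j | i j. i + j = n}"
proof (induction n)
  case 0
  have "{u ^ i * v ^ j | i j. i + j = 0} = {1}" by auto
  then show ?case by (simp only: ideal_pow.simps ideal_gen_1)
next
  case (Suc n)
  have "{s * t | s t. s \<in> {u, v} \<and> t \<in> {u ^ i * v ^ j | i j. i + j = n}} =
        {u ^ i * v ^ j | i j. i + j = Suc n}" (is "?L = ?R")
  proof
    have "\<exists>i' j'. s * (u ^ i * v ^ j) = u ^ i' * v ^ j' \<and> i' + j' = Suc (i + j)"
      if "s \<in> {u, v}" for s i j
    proof -
      have "u * (u ^ i * v ^ j) = u ^ Suc i * v ^ j" "v * (u ^ i * v ^ j) = u ^ i * v ^ Suc j"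
        by (simp_all only: power_Suc mult.assoc mult.left_commute)
      then show ?thesis
        using that by (metis (no_types) add_Suc add_Suc_right insertE singletonD)
    qed
    then show "?L \<subseteq> ?R" by blast
    show "?R \<subseteq> ?L"
    proof clarify
      fix i j assume ij: "i + j = Suc n"
      show "\<exists>s t. u ^ i * v ^ j = s * t \<and> s \<in> {u, v} \<and> t \<in> {u ^ i * v ^ j | i j. i + j = n}"
      proof (cases i)
        case 0
        then have "u ^ i * v ^ j = v * (u ^ 0 * v ^ n)" using ij by simp
        moreover have "0 + n = n" by simp
        ultimately show ?thesis by blast
      next
        case (Suc i')
        then have "u ^ i * v ^ j = u * (u ^ i' * v ^ j)" "i' + j = n" using ij by (simp_all add: mult_ac)
        then show ?thesis by blast
      qed
    qed
  qed
  then show ?case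
    by (simp add: Suc ideal_mult_gen)
qed

text \<open>Digits enter from the lowest upwards, in the order of the factors of
  \<open>gen_frob_power_nat\<close>. For prime p, Kummer's theorem identifies the relation with i +
  j = k and p not dividing the binomial coefficient of k over i.\<close>

inductive no_carry :: "nat \<Rightarrow> nat \<Rightarrow> nat \<Rightarrow> nat \<Rightarrow> bool" for p :: nat where
  zero: "no_carry p 0 0 0"
| step: "no_carry p i j k \<Longrightarrow> a + b < p \<Longrightarrow> no_carry p (a + p * i) (b + p * j) (a + b + p * k)"

lemma no_carry_sum: "no_carry p i j k \<Longrightarrow> i + j = k"
  by (induction rule: no_carry.induct) (auto simp: algebra_simps)

lemma no_carry_0: "no_carry p i j 0 \<longleftrightarrow> i = 0 \<and> j = 0"
  using no_carry_sum[of p i j 0] no_carry.zero[of p] by auto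

lemma no_carry_0_left [simp]: "p > 1 \<Longrightarrow> no_carry p 0 k k"
proof (induction k rule: less_induct)
  case (less k)
  show ?case
  proof (cases "k = 0")
    case False
    then have "no_carry p 0 (k div p) (k div p)" using less by auto
    from no_carry.step[OF this, of 0 "k mod p"] less.prems show ?thesis by simp
  qed (simp add: no_carry.zero)
qed

lemma no_carry_commute: "no_carry p i j k \<Longrightarrow> no_carry p j i k"
proof (induction rule: no_carry.induct)
  case (step i j k a b)
  then show ?case using no_carry.step[of p j i k b a] by (simp add: add_ac)
qed (rule no_carry.zero)

lemma no_carry_0_right [simp]: "p > 1 \<Longrightarrow> no_carry p k 0 k"
  by (rule no_carry_commute) simp

text \<open>The inductive rule adds a digit at the bottom, while the later arguments choose the
  leading digit. Peeling off lowest digits by induction on e moves the new digit to position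
  e.\<close>

lemma no_carry_top:
  assumes "no_carry p i j k" "k < p ^ e" "a + b < p"
  shows "no_carry p (i + a * p ^ e) (j + b * p ^ e) (k + (a + b) * p ^ e)"
  using assms
proof (induction e arbitrary: i j k)
  case 0
  then show ?case
    using no_carry.step[OF no_carry.zero 0(3)] by (simp add: no_carry_0)
next
  case (Suc e)
  from Suc.prems(1) show ?case
  proof cases
    case zero
    \<comment> \<open>Zero may have fewer than e digits, so it is padded with a zero digit at the
      bottom.\<close>
    have "no_carry p (0 + a * p ^ e) (0 + b * p ^ e) (0 + (a + b) * p ^ e)"
      using Suc no_carry.zero by (metis less_nat_zero_code linorder_neqE_nat power_eq_0_iff add_is_0)
    from no_carry.step[OF this, of 0 0] show ?thesis using zero Suc.prems
      by (simp add: mult_ac)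
  next
    case (step i' j' k' c d)
    have "p * k' < p * p ^ e" using step(3) Suc.prems(2) unfolding power_Suc by linarith
    then have "k' < p ^ e" by (metis mult_less_cancel1)
    from no_carry.step[OF Suc.IH[OF step(4) this Suc.prems(3)] step(5)] show ?thesis
      using step by (simp add: algebra_simps)
  qed
qed

text \<open>Without carries, nothing passes from the e lowest digits into the higher ones, so
  truncation commutes with the addition.\<close>

lemma no_carry_div: "no_carry p i j k \<Longrightarrow> i div p ^ e + j div p ^ e = k div p ^ e"
proof (induction arbitrary: e rule: no_carry.induct)
  case (step i j k a b)
  show ?case
  proof (cases e)
    case 0
    then show ?thesis using no_carry_sum[OF step(1)] by (auto simp: algebra_simps)
  next
    case (Suc e')
    have "(c + p * l) div p ^ e = l div p ^ e'" if "c < p" for c l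
      using that by (simp add: Suc div_mult2_eq)
    then show ?thesis using step by simp
  qed
qed simp

text \<open>The factor of each digit contributes one pair (a, b) with a + b equal to that digit.
  Choosing a pair for every digit is the same as writing k = i + j without carries.\<close>

lemma gen_frob_power_nat_gen2:
  fixes u v :: "'a::comm_ring_1"
  assumes "prime CHAR('a)" "p = CHAR('a)"
  shows "gen_frob_power_nat p (ideal_gen {u, v}) k = ideal_gen {u ^ i * v ^ j | i j. no_carry p i j k}"
proof -
  let ?I = "ideal_gen {u, v}"
  have p: "p > 1" using assms prime_gt_1_nat by metis
  \<comment> \<open>Removing the lowest digit raises all remaining Frobenius exponents by one. The
    claim is therefore generalized to an extra twist by p^m, and the induction hypothesis is used at
    \<open>Suc m\<close>.\<close>
  have "foldr ideal_mult
      (map (\<lambda>i. frob_power (p ^ (m + i)) (ideal_pow ?I (k div p ^ i mod p))) [0..<floorlog p k]) UNIV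
    = ideal_gen ((\<lambda>f. f ^ (p ^ m)) ` {u ^ i * v ^ j | i j. no_carry p i j k})" for m
  proof (induction k arbitrary: m rule: less_induct)
    case (less k)
    show ?case
    proof (cases "k = 0")
      case True
      have "(\<lambda>f. f ^ (p ^ m)) ` {u ^ i * v ^ j | i j. no_carry p i j k} = {1}"
        using True by (auto simp: no_carry_0)
      then show ?thesis using True by (simp add: floorlog_def ideal_gen_1)
    next
      case False
      have fp: "frob_power (p ^ m) (ideal_gen S) = ideal_gen ((\<lambda>f. f ^ (p ^ m)) ` S)" for S :: "'a set"
        by (rule frob_power_gen) (simp_all add: assms)
      have "floorlog p k = Suc (floorlog p (k div p))"
        using False p compute_floorlog[of p k] by simp
      then have fl: "[0..<floorlog p k] = 0 # map Suc [0..<floorlog p (k div p)]"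
        by (simp add: upt_conv_Cons map_Suc_upt del: upt_Suc)
      have IH: "foldr ideal_mult
          (map (\<lambda>i. frob_power (p ^ (Suc m + i)) (ideal_pow ?I (k div p div p ^ i mod p)))
            [0..<floorlog p (k div p)]) UNIV
        = ideal_gen ((\<lambda>f. f ^ (p ^ Suc m)) ` {u ^ i * v ^ j | i j. no_carry p i j (k div p)})"
        by (rule less) (use False p in auto)
      have "foldr ideal_mult
          (map (\<lambda>i. frob_power (p ^ (m + i)) (ideal_pow ?I (k div p ^ i mod p))) [0..<floorlog p k]) UNIV
        = ideal_mult (frob_power (p ^ m) (ideal_pow ?I (k mod p)))
          (foldr ideal_mult
          (map (\<lambda>i. frob_power (p ^ (Suc m + i)) (ideal_pow ?I (k div p div p ^ i mod p)))
            [0..<floorlog p (k div p)]) UNIV)"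
        unfolding fl by (simp add: o_def div_mult2_eq)
      also have "\<dots> = ideal_gen {s * t | s t.
          s \<in> (\<lambda>f. f ^ (p ^ m)) ` {u ^ a * v ^ b | a b. a + b = k mod p} \<and>
          t \<in> (\<lambda>f. f ^ (p ^ Suc m)) ` {u ^ i * v ^ j | i j. no_carry p i j (k div p)}}"
        unfolding IH unfolding ideal_pow_gen2 fp ideal_mult_gen ..
      also have "{s * t | s t.
          s \<in> (\<lambda>f. f ^ (p ^ m)) ` {u ^ a * v ^ b | a b. a + b = k mod p} \<and>
          t \<in> (\<lambda>f. f ^ (p ^ Suc m)) ` {u ^ i * v ^ j | i j. no_carry p i j (k div p)}}
        = (\<lambda>f. f ^ (p ^ m)) ` {u ^ i * v ^ j | i j. no_carry p i j k}" (is "?L = ?R")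
      proof -
        have eq: "(u ^ a * v ^ b) ^ (p ^ m) * (u ^ i * v ^ j) ^ (p ^ Suc m)
            = (u ^ (a + p * i) * v ^ (b + p * j)) ^ (p ^ m)" for a b i j
        proof -
          have "f ^ (p ^ m) * g ^ (p ^ Suc m) = (f * g ^ p) ^ (p ^ m)" for f g :: 'a
            by (simp add: power_mult_distrib flip: power_mult)
          moreover have "(u ^ a * v ^ b) * (u ^ i * v ^ j) ^ p = u ^ (a + p * i) * v ^ (b + p * j)"
          proof -
            have "(f ^ n) ^ p = f ^ (p * n)" for f :: 'a and n
              by (simp only: mult.commute[of p] power_mult)
            then show ?thesis
              by (simp only: power_add power_mult_distrib mult.assoc mult.left_commute)
          qed
          ultimately show ?thesis by (simp only:)
        qed
        show ?thesis
        proof (intro equalityI subsetI)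
          fix f assume "f \<in> ?L"
          then obtain a b i j where *: "a + b = k mod p" "no_carry p i j (k div p)"
            "f = (u ^ a * v ^ b) ^ (p ^ m) * (u ^ i * v ^ j) ^ (p ^ Suc m)"
            by blast
          have "no_carry p (a + p * i) (b + p * j) k"
            using no_carry.step[OF *(2), of a b] *(1) p by simp
          then show "f \<in> ?R" using *(3) eq by blast
        next
          fix f assume "f \<in> ?R"
          then obtain i j where *: "no_carry p i j k" "f = (u ^ i * v ^ j) ^ (p ^ m)" by blast
          from *(1) show "f \<in> ?L"
          proof cases
            case zero
            then show ?thesis using False by simp
          next
            case (step i' j' k' a b)
            have "a + b = k mod p" and k': "no_carry p i' j' (k div p)" using step by auto
            then have "u ^ a * v ^ b \<in> {u ^ a * v ^ b | a b. a + b = k mod p}" by blast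
            moreover have "u ^ i' * v ^ j' \<in> {u ^ i * v ^ j | i j. no_carry p i j (k div p)}"
              using k' by blast
            moreover have "f = (u ^ a * v ^ b) ^ (p ^ m) * (u ^ i' * v ^ j') ^ (p ^ Suc m)"
              using step(1,2) *(2) eq by (simp only:)
            ultimately show ?thesis by blast
          qed
        qed
      qed
      finally show ?thesis .
    qed
  qed
  from this[of 0] show ?thesis unfolding gen_frob_power_nat_def by simp
qed

subsection \<open>Frobenius roots of monomial ideals\<close>

abbreviation monomial :: "('v \<Rightarrow>\<^sub>0 nat) \<Rightarrow> ('v \<Rightarrow>\<^sub>0 nat) \<Rightarrow>\<^sub>0 'k::field" where
  "monomial \<alpha> \<equiv> Poly_Mapping.single \<alpha> 1"

abbreviation exp_div :: "nat \<Rightarrow> ('v \<Rightarrow>\<^sub>0 nat) \<Rightarrow> ('v \<Rightarrow>\<^sub>0 nat)" where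
  "exp_div q \<equiv> Poly_Mapping.map (\<lambda>n. n div q)"

abbreviation exp_mod :: "nat \<Rightarrow> ('v \<Rightarrow>\<^sub>0 nat) \<Rightarrow> ('v \<Rightarrow>\<^sub>0 nat)" where
  "exp_mod q \<equiv> Poly_Mapping.map (\<lambda>n. n mod q)"

abbreviation exp_mult :: "nat \<Rightarrow> ('v \<Rightarrow>\<^sub>0 nat) \<Rightarrow> ('v \<Rightarrow>\<^sub>0 nat)" where
  "exp_mult q \<equiv> Poly_Mapping.map ((*) q)"

lemma lookup_map:
  "f 0 = 0 \<Longrightarrow> Poly_Mapping.lookup (Poly_Mapping.map f \<alpha>) v = f (Poly_Mapping.lookup \<alpha> v)"
  by transfer (auto simp: when_def)

text \<open>Division with remainder in each coordinate. The second assumption says that all entries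
  of \<rho> are below q, which makes quotient and remainder unique.\<close>

lemma exp_eq_iff:
  assumes "q > 0" "exp_mod q \<rho> = \<rho>"
  shows "\<alpha> = exp_mult q \<beta> + \<rho> \<longleftrightarrow> exp_mod q \<alpha> = \<rho> \<and> exp_div q \<alpha> = \<beta>"
proof -
  have \<rho>: "Poly_Mapping.lookup \<rho> v < q" for v
    using assms by (metis lookup_map mod_0 mod_less_divisor)
  show ?thesis
    unfolding poly_mapping_eq_iff fun_eq_iff
    using \<rho> assms(1) by (auto simp: lookup_map lookup_add) (metis mult_div_mod_eq)
qed

lemma single_power: "Poly_Mapping.single \<alpha> c ^ n = Poly_Mapping.single (exp_mult n \<alpha>) (c ^ n)"
  for c :: "'k::field" and \<alpha> :: "'v \<Rightarrow>\<^sub>0 nat"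
proof (induction n)
  case 0
  have "exp_mult 0 \<alpha> = 0" by (rule poly_mapping_eqI) (simp add: lookup_map)
  then show ?case by (simp only: power_0 single_one)
next
  case (Suc n)
  have "exp_mult (Suc n) \<alpha> = \<alpha> + exp_mult n \<alpha>"
    by (rule poly_mapping_eqI) (simp add: lookup_map lookup_add)
  then show ?case by (simp only: power_Suc Suc mult_single mult_1)
qed

text \<open>Reduces an identity between additive expressions to single terms.\<close>

lemma poly_mapping_additive_induct [case_names zero single add]:
  assumes "P 0" "\<And>a c. P (Poly_Mapping.single a c)" "\<And>f g. P f \<Longrightarrow> P g \<Longrightarrow> P (f + g)"
  shows "P (f :: 'b \<Rightarrow>\<^sub>0 'k::ab_group_add)"
proof (induction f rule: update_induct)
  case const
  then show ?case using assms(1) by simp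
next
  case (update f a b)
  have "Poly_Mapping.update a b f = f + Poly_Mapping.single a b"
    by (rule poly_mapping_eqI)
      (use update in \<open>auto simp: lookup_update lookup_add lookup_single in_keys_iff\<close>)
  then show ?case using assms update by simp
qed

lemma CHAR_poly_mapping: "CHAR('b::comm_monoid_add \<Rightarrow>\<^sub>0 'k::comm_semiring_1) = CHAR('k)"
proof (rule CHAR_eqI)
  have "of_nat n = (0 :: 'b \<Rightarrow>\<^sub>0 'k) \<longleftrightarrow> of_nat n = (0 :: 'k)" for n
    using inj_eq[OF inj_single, of "0 :: 'b" "of_nat n :: 'k" 0] by simp
  then show "of_nat CHAR('k) = (0 :: 'b \<Rightarrow>\<^sub>0 'k)" "\<And>n. of_nat n = (0 :: 'b \<Rightarrow>\<^sub>0 'k) \<Longrightarrow> CHAR('k) dvd n"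
    by (simp_all add: of_nat_eq_0_iff_char_dvd)
qed

text \<open>A \<open>K\<^sup>q\<close>-linear retraction of \<open>K\<close> onto \<open>K\<^sup>q\<close>, with \<open>K\<^sup>q\<close> identified with \<open>K\<close> by Frobenius.\<close>

lemma frobenius_splitting:
  assumes "prime CHAR('k::field)" "q = CHAR('k::field) ^ e"
  obtains \<pi> :: "'k::field \<Rightarrow> 'k"
  where "\<And>a b. \<pi> (a + b) = \<pi> a + \<pi> b" "\<And>a c. \<pi> (c ^ q * a) = c * \<pi> a" "\<pi> 1 = 1"
proof -
  have q: "q > 0" using assms by (simp add: prime_gt_0_nat)
  \<comment> \<open>K acts on itself through q-th powers; additivity in the scalar is the freshman's
    dream. Over this action 1 is a nonzero vector, so the assignment 1 -> 1 extends to a linear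
    map.\<close>
  interpret vector_space_pair "\<lambda>c a :: 'k. c ^ q * a" "(*) :: 'k \<Rightarrow> 'k \<Rightarrow> 'k"
    by unfold_locales
      (use freshmans_dream'[OF assms] in \<open>simp_all add: algebra_simps power_mult_distrib\<close>)
  have "vs1.independent {1 :: 'k}"
    by (simp add: vs1.independent_insert)
  from linear_independent_extend[OF this, of "\<lambda>_. 1"] obtain \<pi> :: "'k \<Rightarrow> 'k"
    where \<pi>: "Vector_Spaces.linear (\<lambda>c a. c ^ q * a) (*) \<pi>" "\<pi> 1 = 1"
    by auto
  show thesis
  proof (rule that)
    show "\<pi> (a + b) = \<pi> a + \<pi> b" for a b using linear_add[OF \<pi>(1)] .
    show "\<pi> (c ^ q * a) = c * \<pi> a" for a c using linear_scale[OF \<pi>(1)] .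
  qed (rule \<pi>)
qed

text \<open>A map \<psi> with \<psi>(f^q g) = f \<psi>(g) sends the q-th Frobenius power of L into
  L. It is built so that the monomial of \<alpha> goes to the monomial of
  \<open>exp_div q \<alpha>\<close>.\<close>

lemma monomial_in_frob_power:
  fixes L :: "(('v \<Rightarrow>\<^sub>0 nat) \<Rightarrow>\<^sub>0 'k::field) set"
  assumes p: "prime CHAR('k)" and q: "q = CHAR('k) ^ e"
    and L: "is_ideal L" and \<alpha>: "monomial \<alpha> \<in> frob_power q L"
  shows "monomial (exp_div q \<alpha>) \<in> L"
proof -
  have q0: "q > 0" using p q by (simp add: prime_gt_0_nat)
  obtain \<pi> :: "'k \<Rightarrow> 'k" where \<pi>: "\<And>a b. \<pi> (a + b) = \<pi> a + \<pi> b" "\<And>a c. \<pi> (c ^ q * a) = c * \<pi> a" "\<pi> 1 = 1"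
    using frobenius_splitting[OF p q] by blast
  have \<pi>0: "\<pi> 0 = 0" using \<pi>(2)[of 0 0] q0 by simp
  define \<rho> where "\<rho> = exp_mod q \<alpha>"
  have \<rho>: "exp_mod q \<rho> = \<rho>"
    unfolding \<rho>_def by (rule poly_mapping_eqI) (simp add: lookup_map)
  note eq_iff = exp_eq_iff[OF q0 \<rho>]
  \<comment> \<open>Keep the terms whose exponents are congruent to \<alpha> modulo q, divide these
    exponents by q, and apply the splitting \<pi> to the coefficients.\<close>
  define \<psi> :: "(('v \<Rightarrow>\<^sub>0 nat) \<Rightarrow>\<^sub>0 'k) \<Rightarrow> ('v \<Rightarrow>\<^sub>0 nat) \<Rightarrow>\<^sub>0 'k"
    where "\<psi> g = Poly_Mapping.map \<pi> (Poly_Mapping.map_key (\<lambda>\<beta>. exp_mult q \<beta> + \<rho>) g)" for g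
  have inj: "inj (\<lambda>\<beta>. exp_mult q \<beta> + \<rho>)"
    by (rule inj_on_inverseI[of _ "exp_div q"]) (use eq_iff in blast)
  have lookup_\<psi>: "Poly_Mapping.lookup (\<psi> g) \<beta> = \<pi> (Poly_Mapping.lookup g (exp_mult q \<beta> + \<rho>))" for g \<beta>
    by (simp add: \<psi>_def Poly_Mapping.map.rep_eq Poly_Mapping.map_key.rep_eq inj \<pi>0 when_def)
  have \<psi>_add: "\<psi> (f + g) = \<psi> f + \<psi> g" for f g
    by (rule poly_mapping_eqI) (simp add: lookup_\<psi> lookup_add \<pi>(1))
  have \<psi>_0: "\<psi> 0 = 0"
    by (rule poly_mapping_eqI) (simp add: lookup_\<psi> \<pi>0)
  have \<psi>_single: "\<psi> (Poly_Mapping.single \<gamma> c) =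
      (if exp_mod q \<gamma> = \<rho> then Poly_Mapping.single (exp_div q \<gamma>) (\<pi> c) else 0)" for \<gamma> c
    by (rule poly_mapping_eqI) (use eq_iff[of \<gamma>] in \<open>auto simp: lookup_\<psi> lookup_single when_def \<pi>0\<close>)
  \<comment> \<open>Both sides are additive in f and in g, so single terms suffice; there f^q
    changes no residue modulo q, and \<pi> extracts the q-th root of its coefficient.\<close>
  have \<psi>_mult: "\<psi> (f ^ q * g) = f * \<psi> g" for f g
  proof (induction f rule: poly_mapping_additive_induct)
    case zero
    then show ?case using q0 \<psi>_0 by (simp add: power_0_left)
  next
    case (single \<gamma> c)
    show ?case
    proof (induction g rule: poly_mapping_additive_induct)
      case (single \<delta> d)
      have "exp_mod q (exp_mult q \<gamma> + \<delta>) = exp_mod q \<delta>" "exp_div q (exp_mult q \<gamma> + \<delta>) = \<gamma> + exp_div q \<delta>"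
        by (rule poly_mapping_eqI; use q0 in \<open>simp add: lookup_map lookup_add\<close>)+
      then show ?case
        by (simp add: single_power mult_single \<psi>_single \<pi>(2))
    qed (simp_all add: \<psi>_0 \<psi>_add distrib_left)
  next
    case (add f f')
    have "(f + f') ^ q = f ^ q + f' ^ q"
      by (rule freshmans_dream') (use p q in \<open>simp_all add: CHAR_poly_mapping\<close>)
    then show ?case using add by (simp add: distrib_right \<psi>_add)
  qed
  have "\<psi> g \<in> L" if "g \<in> frob_power q L" for g
    using that unfolding frob_power_def
  proof (induction rule: ideal.span_induct_alt)
    case base
    then show ?case using L \<psi>_0 ideal.subspace_0 by simp
  next
    case (step h x y)
    then obtain f where "f \<in> L" "x = f ^ q" by blast
    then have "\<psi> (h * x + y) = \<psi> h * f + \<psi> y"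
      using \<psi>_mult[of f h] by (simp add: \<psi>_add mult.commute)
    then show ?case
      using step \<open>f \<in> L\<close> L by (simp add: ideal.subspace_add ideal.subspace_scale)
  qed
  from this[OF \<alpha>] show ?thesis
    by (simp add: \<psi>_single \<rho>_def \<pi>(3))
qed

text \<open>Division with remainder writes each monomial as a multiple of a q-th power of its
  quotient, so the right-hand ideal qualifies. It is least by
  \<open>monomial_in_frob_power\<close>.\<close>

lemma frob_root_monomials:
  fixes A :: "('v \<Rightarrow>\<^sub>0 nat) set"
  assumes p: "prime CHAR('k::field)" and q: "q = CHAR('k) ^ e"
  shows "frob_root q (ideal_gen ((monomial :: _ \<Rightarrow> _ \<Rightarrow>\<^sub>0 'k) ` A)) = ideal_gen ((\<lambda>\<alpha>. monomial (exp_div q \<alpha>)) ` A)"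
    (is "frob_root q ?J = ?L")
  unfolding frob_root_def
proof (rule Least_equality)
  have q0: "q > 0" using p q by (simp add: prime_gt_0_nat)
  have "monomial \<alpha> \<in> frob_power q ?L" if "\<alpha> \<in> A" for \<alpha>
  proof -
    have "\<alpha> = exp_mod q \<alpha> + exp_mult q (exp_div q \<alpha>)"
      by (rule poly_mapping_eqI) (simp add: lookup_map lookup_add)
    then have "(monomial \<alpha> :: _ \<Rightarrow>\<^sub>0 'k) = monomial (exp_mod q \<alpha>) * monomial (exp_div q \<alpha>) ^ q"
      by (simp add: single_power mult_single)
    moreover have "(monomial (exp_div q \<alpha>) :: _ \<Rightarrow>\<^sub>0 'k) ^ q \<in> frob_power q ?L"
      unfolding frob_power_def using that by (blast intro: ideal.span_base)
    ultimately show ?thesis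
      unfolding frob_power_def by (simp add: ideal.span_scale)
  qed
  then have "?J \<subseteq> frob_power q ?L"
    unfolding frob_power_def by (intro ideal.span_minimal ideal.subspace_span) auto
  then show "is_ideal ?L \<and> ?J \<subseteq> frob_power q ?L"
    by (simp add: ideal.subspace_span)
next
  fix L :: "(('v \<Rightarrow>\<^sub>0 nat) \<Rightarrow>\<^sub>0 'k) set"
  assume L: "is_ideal L \<and> ?J \<subseteq> frob_power q L"
  then have "monomial (exp_div q \<alpha>) \<in> L" if "\<alpha> \<in> A" for \<alpha>
    using that monomial_in_frob_power[OF p q] ideal.span_superset by blast
  then show "?L \<subseteq> L"
    using L by (intro ideal.span_minimal) auto
qed

subsection \<open>Generalized Frobenius powers of \<open>(x\<^sup>2y\<^sup>2, y\<^sup>3z\<^sup>3)\<close>\<close>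

abbreviation xyz_monom :: "nat \<Rightarrow> nat \<Rightarrow> nat \<Rightarrow> 'k::field poly3" where
  "xyz_monom a b c \<equiv> Var X ^ a * Var Y ^ b * Var Z ^ c"

definition xyz_exp :: "nat \<Rightarrow> nat \<Rightarrow> nat \<Rightarrow> xyz \<Rightarrow>\<^sub>0 nat" where
  "xyz_exp a b c = Poly_Mapping.single X a + Poly_Mapping.single Y b + Poly_Mapping.single Z c"

lemma xyz_monom_eq: "xyz_monom a b c = monomial (xyz_exp a b c)"
  by (simp add: Var_def single_power mult_single xyz_exp_def)

lemma exp_div_xyz_exp: "exp_div q (xyz_exp a b c) = xyz_exp (a div q) (b div q) (c div q)"
proof (rule poly_mapping_eqI)
  fix v show "Poly_Mapping.lookup (exp_div q (xyz_exp a b c)) v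
      = Poly_Mapping.lookup (xyz_exp (a div q) (b div q) (c div q)) v"
    by (cases v) (simp_all add: lookup_map xyz_exp_def lookup_add lookup_single)
qed

lemma gen_frob_power_rat_xyz:
  assumes "prime p" "CHAR('k::field) = p"
  shows "gen_frob_power_rat p (ideal_gen {xyz_monom 2 2 0, xyz_monom 0 3 3 :: 'k poly3}) k e
    = ideal_gen {xyz_monom (2 * i div p ^ e) ((2 * i + 3 * j) div p ^ e) (3 * j div p ^ e)
        | i j. no_carry p i j k}"
proof -
  let ?A = "{xyz_exp (2 * i) (2 * i + 3 * j) (3 * j) | i j. no_carry p i j k}"
  have "xyz_monom 2 2 0 ^ i * xyz_monom 0 3 3 ^ j
      = (xyz_monom (2 * i) (2 * i + 3 * j) (3 * j) :: 'k poly3)" for i j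
    by (simp add: power_mult_distrib power_add mult_ac flip: power_mult)
  then have "{xyz_monom 2 2 0 ^ i * xyz_monom 0 3 3 ^ j | i j. no_carry p i j k}
      = (monomial :: _ \<Rightarrow> 'k poly3) ` ?A"
    unfolding xyz_monom_eq by (simp only: image_Collect) blast
  then have "gen_frob_power_nat p (ideal_gen {xyz_monom 2 2 0, xyz_monom 0 3 3 :: 'k poly3}) k
      = ideal_gen (monomial ` ?A)"
    using gen_frob_power_nat_gen2[where 'a = "'k poly3"] assms by (simp only: CHAR_poly_mapping)
  then have "gen_frob_power_rat p (ideal_gen {xyz_monom 2 2 0, xyz_monom 0 3 3 :: 'k poly3}) k e
      = ideal_gen ((\<lambda>\<alpha>. monomial (exp_div (p ^ e) \<alpha>)) ` ?A)"
    unfolding gen_frob_power_rat_def using assms by (simp only: frob_root_monomials)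
  also have "((\<lambda>\<alpha>. monomial (exp_div (p ^ e) \<alpha>)) ` ?A) =
      {xyz_monom (2 * i div p ^ e) ((2 * i + 3 * j) div p ^ e) (3 * j div p ^ e) :: 'k poly3
        | i j. no_carry p i j k}"
    unfolding xyz_monom_eq exp_div_xyz_exp[symmetric] by (simp only: image_Collect) blast
  finally show ?thesis .
qed

text \<open>A sequence decreasing to t stays at or above a and is eventually below b, so its powers
  eventually equal L. The description is unique only if some admissible sequence exists, and one is
  constructed.\<close>

lemma gen_frob_power_eqI:
  assumes p: "p > 1"
    and const: "\<And>k e. a \<le> real k / real (p ^ e) \<Longrightarrow> real k / real (p ^ e) < b \<Longrightarrow>
        gen_frob_power_rat p I k e = L"
    and t: "t \<in> {a..<b}" "t \<ge> 0"
  shows "gen_frob_power p I t = L"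
proof -
  have ev: "\<forall>\<^sub>F j in sequentially. gen_frob_power_rat p I (k j) (e j) = L"
    if dec: "decseq (\<lambda>j. real (k j) / real (p ^ e j))"
      and lim: "(\<lambda>j. real (k j) / real (p ^ e j)) \<longlonglongrightarrow> t" for k e
  proof -
    have lo: "a \<le> real (k j) / real (p ^ e j)" for j
      using decseq_ge[OF dec lim, of j] t by simp
    have "\<forall>\<^sub>F j in sequentially. real (k j) / real (p ^ e j) < b"
      using order_tendstoD(2)[OF lim, of b] t by simp
    then show ?thesis
      by (rule eventually_mono) (rule const[OF lo])
  qed
  \<comment> \<open>Round t up to denominator p^j. The sequence decreases because p times the old
    numerator is an integer at least t p^(j+1), and it exceeds t by at most p^(-j).\<close>
  define k where "k j = nat \<lceil>t * real (p ^ j)\<rceil>" for j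
  have k: "real (k j) = of_int \<lceil>t * real (p ^ j)\<rceil>" for j
    unfolding k_def using t by simp
  have "real (k (Suc j)) \<le> real p * real (k j)" for j
  proof -
    have "t * real (p ^ Suc j) \<le> real p * of_int \<lceil>t * real (p ^ j)\<rceil>"
      using mult_left_mono[OF le_of_int_ceiling[of "t * real (p ^ j)"], of "real p"]
      by (simp add: mult_ac)
    then have "\<lceil>t * real (p ^ Suc j)\<rceil> \<le> int p * \<lceil>t * real (p ^ j)\<rceil>"
      by (simp add: ceiling_le_iff)
    then show ?thesis unfolding k by (metis of_int_le_iff of_int_mult of_int_of_nat_eq)
  qed
  then have dec: "decseq (\<lambda>j. real (k j) / real (p ^ j))"
    using p by (intro decseq_SucI) (simp add: field_simps)
  have lim: "(\<lambda>j. real (k j) / real (p ^ j)) \<longlonglongrightarrow> t"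
  proof (rule tendsto_sandwich[of "\<lambda>_. t" _ _ "\<lambda>j. t + (1 / real p) ^ j"])
    have "(\<lambda>j. (1 / real p) ^ j) \<longlonglongrightarrow> 0"
      using p by (intro LIMSEQ_realpow_zero) auto
    then show "(\<lambda>j. t + (1 / real p) ^ j) \<longlonglongrightarrow> t"
      using tendsto_add[OF tendsto_const[of t]] by fastforce
    show "(\<lambda>_. t) \<longlonglongrightarrow> t" by simp
    have "t * real (p ^ j) \<le> real (k j)" "real (k j) \<le> t * real (p ^ j) + 1" for j
      unfolding k by linarith+
    then show "\<forall>\<^sub>F j in sequentially. t \<le> real (k j) / real (p ^ j)"
        "\<forall>\<^sub>F j in sequentially. real (k j) / real (p ^ j) \<le> t + (1 / real p) ^ j"
      using p by (auto intro!: always_eventually simp: field_simps)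
  qed
  show ?thesis
    unfolding gen_frob_power_def
  proof (rule the_equality)
    fix L' assume "\<forall>k e. decseq (\<lambda>j. real (k j) / real (p ^ e j)) \<longrightarrow>
        (\<lambda>j. real (k j) / real (p ^ e j)) \<longlonglongrightarrow> t \<longrightarrow>
        (\<forall>\<^sub>F j in sequentially. gen_frob_power_rat p I (k j) (e j) = L')"
    then have "\<forall>\<^sub>F j in sequentially. gen_frob_power_rat p I (k j) j = L'"
      using dec lim by (auto dest!: spec[of _ k] spec[of _ "\<lambda>j. j"])
    moreover have "\<forall>\<^sub>F j in sequentially. gen_frob_power_rat p I (k j) j = L"
      by (rule ev[of k "\<lambda>j. j", OF dec lim])
    ultimately have "\<forall>\<^sub>F j :: nat in sequentially. L' = L"
      by (rule eventually_elim2) simp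
    then show "L' = L" by simp
  qed (use ev in blast)
qed

text \<open>T lists the exponents of the expected generators. \<open>upper\<close> says that each
  actual generator is a multiple of an expected one, \<open>lower\<close> the converse. Floors and
  fractions are cleared, leaving inequalities between natural numbers.\<close>

lemma gen_frob_power_xyz:
  fixes T :: "(nat \<times> nat \<times> nat) set"
  assumes p: "prime p" "CHAR('k::field) = p"
    and I: "I = ideal_gen {Var X ^ 2 * Var Y ^ 2, Var Y ^ 3 * Var Z ^ 3 :: 'k poly3}"
    and d: "d > 0" "d' > 0"
    and ab: "a = real n / real d" "b = real n' / real d'"
    and upper: "\<And>k q e i j. no_carry p i j k \<Longrightarrow> q = p ^ e \<Longrightarrow> n * q \<le> d * k \<Longrightarrow> d' * k < n' * q \<Longrightarrow>
        \<exists>(r, s, t) \<in> T. r * q \<le> 2 * i \<and> s * q \<le> 2 * i + 3 * j \<and> t * q \<le> 3 * j"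
    and lower: "\<And>k q e r s t. q = p ^ e \<Longrightarrow> n * q \<le> d * k \<Longrightarrow> d' * k < n' * q \<Longrightarrow> (r, s, t) \<in> T \<Longrightarrow>
        \<exists>i j. no_carry p i j k \<and> 2 * i < (r + 1) * q \<and> 2 * i + 3 * j < (s + 1) * q \<and> 3 * j < (t + 1) * q"
  shows "\<forall>t \<in> {a..<b}.
    gen_frob_power p I t = ideal_gen ((\<lambda>(r, s, t). xyz_monom r s t) ` T)"
proof
  fix t assume "t \<in> {a..<b}"
  then have t: "t \<in> {real n / real d..<real n' / real d'}" unfolding ab .
  have p1: "p > 1" using p prime_gt_1_nat by blast
  have "0 \<le> real n / real d" by simp
  then have t0: "t \<ge> 0" using t unfolding atLeastLessThan_iff by linarith
  show "gen_frob_power p I t = ideal_gen ((\<lambda>(r, s, t). xyz_monom r s t) ` T)"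
  proof (rule gen_frob_power_eqI[OF p1 _ t t0])
    fix k e
    define q where "q = p ^ e"
    have q: "q > 0" using p1 by (simp add: q_def)
    assume "real n / real d \<le> real k / real (p ^ e)" "real k / real (p ^ e) < real n' / real d'"
    then have "real n * real q \<le> real d * real k" "real d' * real k < real n' * real q"
      unfolding q_def[symmetric] using d q by (simp_all add: field_simps)
    then have k: "n * q \<le> d * k" "d' * k < n' * q"
      by (simp_all flip: of_nat_mult)
    have I': "I = ideal_gen {xyz_monom 2 2 0, xyz_monom 0 3 3}"
      unfolding I by simp
    show "gen_frob_power_rat p I k e = ideal_gen ((\<lambda>(r, s, t). xyz_monom r s t) ` T)"
      unfolding I' gen_frob_power_rat_xyz[OF p] q_def[symmetric]
    proof (rule ideal_gen_eq_dvdI)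
      fix f :: "'k poly3"
      assume "f \<in> {xyz_monom (2 * i div q) ((2 * i + 3 * j) div q) (3 * j div q) | i j. no_carry p i j k}"
      then obtain i j where f: "f = xyz_monom (2 * i div q) ((2 * i + 3 * j) div q) (3 * j div q)"
        and "no_carry p i j k" by blast
      from upper[OF this(2) q_def k] obtain r s t where
        "(r, s, t) \<in> T" "r \<le> 2 * i div q" "s \<le> (2 * i + 3 * j) div q" "t \<le> 3 * j div q"
        using q by (auto simp: less_eq_div_iff_mult_less_eq)
      then show "\<exists>g \<in> (\<lambda>(r, s, t). xyz_monom r s t) ` T. g dvd f"
        unfolding f by (intro bexI[of _ "xyz_monom r s t"] mult_dvd_mono le_imp_power_dvd) force+
    next
      fix g :: "'k poly3"
      assume "g \<in> (\<lambda>(r, s, t). xyz_monom r s t) ` T"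
      then obtain r s t where g: "g = xyz_monom r s t" and "(r, s, t) \<in> T" by auto
      from lower[OF q_def k this(2)] obtain i j where ij: "no_carry p i j k"
        "2 * i div q \<le> r" "(2 * i + 3 * j) div q \<le> s" "3 * j div q \<le> t"
        by (auto simp: less_mult_imp_div_less simp flip: less_Suc_eq_le)
      then have "xyz_monom (2 * i div q) ((2 * i + 3 * j) div q) (3 * j div q) dvd g"
        unfolding g by (intro mult_dvd_mono le_imp_power_dvd)
      then show "\<exists>f \<in> {xyz_monom (2 * i div q) ((2 * i + 3 * j) div q) (3 * j div q) | i j. no_carry p i j k}. f dvd g"
        using ij(1) by blast
    qed
  qed
qed

subsection \<open>Leading base-\<open>p\<close> digits\<close>

text \<open>The lower part r uses up less than l units of Q, and the leading digit d leaves room for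
  l of them. With m = 2 and m = 3 this bounds i and j by their leading digits.\<close>

lemma digit_bound:
  fixes m d l n r Q :: nat
  assumes "m * r < l * Q" "m * d + l \<le> n"
  shows "m * (r + d * Q) < n * Q"
proof -
  have "(m * d + l) * Q \<le> n * Q" using assms(2) by (rule mult_le_mono1)
  then show ?thesis using assms(1) by (simp add: algebra_simps)
qed

lemma split_top_digit:
  fixes k p e :: nat
  assumes "k < p ^ Suc e"
  obtains c r where "k = r + c * p ^ e" "r < p ^ e" "c < p"
proof
  have "p ^ e > 0" using assms by (cases "p = 0"; cases e) auto
  then show "k mod p ^ e < p ^ e" by simp
  show "k div p ^ e < p" using assms by (simp add: less_mult_imp_div_less)
  show "k = k mod p ^ e + k div p ^ e * p ^ e" by (simp only: mod_div_mult_eq)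
qed

text \<open>There is a leading digit: for e = 0 the bounds would ask for k < 1 and 1 \<le>
  2k.\<close>

lemma split_top_digit_half:
  fixes k p e :: nat
  assumes "p ^ e \<le> 2 * k" "k < p ^ e"
  obtains e' c r where "e = Suc e'" "k = r + c * p ^ e'" "r < p ^ e'" "c < p"
proof (cases e)
  case 0
  then show ?thesis using assms by simp
next
  case (Suc e')
  then show ?thesis using assms split_top_digit[of k p e'] that by blast
qed

text \<open>A leading digit c with 2(c + 1) \<le> p keeps k itself below half of p^(e+1), so i = k
  and j = 0 will do.\<close>

lemma no_carry_small_digit:
  assumes p: "p > 1" and r: "r < p ^ e" and c: "c \<le> a" "c < p"
    and i: "2 * Suc a \<le> p" and j: "m > 0"
  shows "\<exists>i j. no_carry p i j (r + c * p ^ e) \<and> 2 * i < p ^ Suc e \<and> 3 * j < m * p ^ Suc e"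
proof (intro exI conjI)
  have "p ^ e > 0" using p by simp
  then show "3 * 0 < m * p ^ Suc e" using p j by simp
  show "no_carry p (r + c * p ^ e) 0 (r + c * p ^ e)" using p by simp
  have "2 * (r + c * p ^ e) < p * p ^ e"
    by (rule digit_bound[of 2 r 2]) (use r c i in auto)
  then show "2 * (r + c * p ^ e) < p ^ Suc e" by simp
qed

text \<open>Here h is the largest leading digit that keeps i below one half. Give i this digit
  followed by zeros, and leave the rest of k to j.\<close>

lemma no_carry_shift_digit:
  assumes p: "p = 2 * h + 1" "p > 1" and r: "r < p ^ e" and c: "h \<le> c" "c < p"
    and j: "3 * Suc (c - h) \<le> m * p"
  shows "\<exists>i j. no_carry p i j (r + c * p ^ e) \<and> 2 * i < p ^ Suc e \<and> 3 * j < m * p ^ Suc e"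
proof (intro exI conjI)
  have Q: "p ^ e > 0" using p by simp
  have "no_carry p (0 + h * p ^ e) (r + (c - h) * p ^ e) (r + (h + (c - h)) * p ^ e)"
    by (rule no_carry_top) (use p r c in auto)
  then show "no_carry p (0 + h * p ^ e) (r + (c - h) * p ^ e) (r + c * p ^ e)"
    using c by simp
  have "2 * (0 + h * p ^ e) < p * p ^ e"
    by (rule digit_bound[of 2 0 1]) (use Q p in auto)
  then show "2 * (0 + h * p ^ e) < p ^ Suc e" by simp
  have "3 * (r + (c - h) * p ^ e) < (m * p) * p ^ e"
    by (rule digit_bound[of 3 r 3]) (use r j in auto)
  then show "3 * (r + (c - h) * p ^ e) < m * p ^ Suc e" by (simp add: mult_ac)
qed

lemma no_carry_half_two_thirds:
  assumes p: "prime p" and k: "k < p ^ e"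
  shows "\<exists>i j. no_carry p i j k \<and> 2 * i < p ^ e \<and> 3 * j < 2 * p ^ e"
proof (cases e)
  case 0
  then show ?thesis using k no_carry.zero[of p] by auto
next
  case (Suc e')
  have p1: "p > 1" using p prime_gt_1_nat by blast
  obtain c r where c: "k = r + c * p ^ e'" "r < p ^ e'" "c < p"
    using split_top_digit k Suc by blast
  show ?thesis
  proof (cases "p = 2")
    case True
    \<comment> \<open>In base 2 the top digit goes to j, which is then at most q/2 < 2q/3, and the
      lower digits go to i.\<close>
    have "no_carry p (r + 0 * p ^ e') (0 + c * p ^ e') (r + (0 + c) * p ^ e')"
      by (rule no_carry_top) (use c p1 in auto)
    moreover have "3 * (0 + c * p ^ e') < 4 * p ^ e'"
      by (rule digit_bound[of 3 0 1]) (use c True in auto)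
    ultimately show ?thesis
      using c True Suc by (intro exI[of _ r] exI[of _ "c * p ^ e'"]) auto
  next
    case False
    then have "odd p" using p prime_odd_nat prime_ge_2_nat[OF p] by (metis le_neq_implies_less)
    then obtain h where h: "p = 2 * h + 1" by (elim oddE)
    show ?thesis
    proof (cases "c < h")
      case True
      then show ?thesis
        using no_carry_small_digit[OF p1 c(2), of c c 2] c h Suc by simp
    next
      case False
      \<comment> \<open>Since c \<le> 2h, the digit left for j is at most h, and 3(h + 1) \<le> 2(2h
        + 1) because h is at least 1.\<close>
      then have "3 * Suc (c - h) \<le> 2 * p" using c(3) h p1 by auto
      then show ?thesis
        using no_carry_shift_digit[OF h p1 c(2), of c 2] False c Suc by simp
    qed
  qed
qed

text \<open>In base 6n + 1 all digits of 1/2, 1/3 and 5/6 are 3n, 2n and 5n, so 1/2 + 1/3 = 5/6 has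
  no carries. Only the leading digit 5n is critical, and it leaves the same problem for the
  remaining digits.\<close>

lemma no_carry_half_third:
  assumes p: "p = 6 * n + 1" "n > 0" and k: "6 * k < 5 * p ^ e"
  shows "\<exists>i j. no_carry p i j k \<and> 2 * i < p ^ e \<and> 3 * j < p ^ e"
  using k
proof (induction e arbitrary: k)
  case 0
  then have "k = 0" by simp
  then show ?case using no_carry.zero[of p] by auto
next
  case (Suc e)
  have p1: "p > 1" and h: "p = 2 * (3 * n) + 1" using p by auto
  have "k < p ^ Suc e" using Suc.prems by linarith
  then obtain c r where c: "k = r + c * p ^ e" "r < p ^ e" "c < p"
    by (rule split_top_digit)
  consider "c < 3 * n" | "3 * n \<le> c" "c < 5 * n" | "5 * n \<le> c" by linarith
  then show ?case
  proof cases
    case 1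
    then show ?thesis
      using no_carry_small_digit[OF p1 c(2), of c c 1] c p by simp
  next
    case 2
    then have "3 * Suc (c - 3 * n) \<le> 1 * p" unfolding p(1) by auto
    then show ?thesis
      using no_carry_shift_digit[OF h p1 c(2), of c 1] 2 c by simp
  next
    case 3
    have eq: "5 * p = 6 * (5 * n) + 5" using p by simp
    have "6 * c < 5 * p"
    proof (rule ccontr)
      assume "\<not> 6 * c < 5 * p"
      then have "5 * p * p ^ e \<le> 6 * c * p ^ e" by (intro mult_le_mono1) simp
      then show False using Suc.prems c(1) unfolding power_Suc mult.assoc by linarith
    qed
    then have c5: "c = 5 * n" using 3 eq by linarith
    have "6 * (r + 5 * n * p ^ e) < (6 * (5 * n) + 5) * p ^ e"
      using Suc.prems c(1) c5 eq by (metis mult.assoc power_Suc)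
    then have "6 * r < 5 * p ^ e" by (simp add: algebra_simps)
    from Suc.IH[OF this] obtain i j where ij: "no_carry p i j r" "2 * i < p ^ e" "3 * j < p ^ e"
      by blast
    have "no_carry p (i + 3 * n * p ^ e) (j + 2 * n * p ^ e) (r + (3 * n + 2 * n) * p ^ e)"
      by (rule no_carry_top) (use ij c p in auto)
    moreover have "2 * (i + 3 * n * p ^ e) < p * p ^ e"
      by (rule digit_bound[of 2 i 1]) (use ij p in auto)
    moreover have "3 * (j + 2 * n * p ^ e) < p * p ^ e"
      by (rule digit_bound[of 3 j 1]) (use ij p in auto)
    ultimately show ?thesis
      using c(1) c5 by (intro exI[of _ "i + 3 * n * p ^ e"] exI[of _ "j + 2 * n * p ^ e"]) simp
  qed
qed

text \<open>
  In base \<open>p = 6 n + 5\<close> the leading digits of \<open>1/2\<close> and \<open>1/3\<close> sum to \<open>5 n + 3\<close>,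
  while the digits in the second place already carry.
\<close>

lemma no_carry_half_third':
  assumes p: "prime p" "p = 6 * n + 5" and k: "p * k < (5 * n + 4) * p ^ e"
    and half: "p ^ e \<le> 2 * k"
  shows "\<exists>i j. no_carry p i j k \<and> 2 * i < p ^ e \<and> 3 * j < p ^ e"
proof -
  have p1: "p > 1" and h: "p = 2 * (3 * n + 2) + 1" using p by auto
  have "p * k < p * p ^ e"
    using k p mult_le_mono1[of "5 * n + 4" p "p ^ e"] by linarith
  then have "k < p ^ e" by simp
  from split_top_digit_half[OF half this] obtain e' c r where
    c: "e = Suc e'" "k = r + c * p ^ e'" "r < p ^ e'" "c < p" by blast
  have "p * k < p * ((5 * n + 4) * p ^ e')" using k c(1) by (simp add: mult_ac)
  then have "k < (5 * n + 4) * p ^ e'" by simp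
  then have "c * p ^ e' < (5 * n + 4) * p ^ e'" using c(2) by linarith
  then have "c < 5 * n + 4" by simp
  then consider "c < 3 * n + 2" | "3 * n + 2 \<le> c" "c < 5 * n + 3" | "c = 5 * n + 3" by linarith
  then show ?thesis
  proof cases
    case 1
    then show ?thesis
      using no_carry_small_digit[OF p1 c(3), of c c 1] c p by simp
  next
    case 2
    then have "3 * Suc (c - (3 * n + 2)) \<le> 1 * p" unfolding p(2) by auto
    then show ?thesis
      using no_carry_shift_digit[OF h p1 c(3), of c 1] 2 c by simp
  next
    case 3
    \<comment> \<open>After the leading digit 2n + 1, the bound on j leaves p - 3(2n + 1) = 2 units,
      so the tail of j may reach two thirds; the tail of i must stay below one half.\<close>
    obtain i j where ij: "no_carry p i j r" "2 * i < p ^ e'" "3 * j < 2 * p ^ e'"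
      using no_carry_half_two_thirds[OF p(1) c(3)] by blast
    have "no_carry p (i + (3 * n + 2) * p ^ e') (j + (2 * n + 1) * p ^ e')
        (r + ((3 * n + 2) + (2 * n + 1)) * p ^ e')"
      by (rule no_carry_top) (use ij c p in auto)
    moreover have "(3 * n + 2) + (2 * n + 1) = c" using 3 by simp
    moreover have "2 * (i + (3 * n + 2) * p ^ e') < p * p ^ e'"
      by (rule digit_bound[of 2 i 1]) (use ij p in auto)
    moreover have "3 * (j + (2 * n + 1) * p ^ e') < p * p ^ e'"
      by (rule digit_bound[of 3 j 2]) (use ij p in auto)
    ultimately show ?thesis
      using c(1,2) by (metis power_Suc)
  qed
qed

text \<open>The bound on i forces i div p^e \<le> a. As there are no carries, j must supply at least
  N - a at that position.\<close>

lemma no_carry_digit_ge: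
  assumes nc: "no_carry p i j k" and Q: "p ^ e > 0" and i: "2 * i < p * p ^ e"
    and k: "N * p ^ e \<le> k" and a: "p \<le> 2 * a + 2"
  shows "(N - a) * p ^ e \<le> j"
proof -
  have "2 * (i div p ^ e) * p ^ e \<le> 2 * i"
    by (metis div_times_less_eq_dividend mult.assoc mult_le_mono2)
  then have "2 * (i div p ^ e) * p ^ e < p * p ^ e" using i by linarith
  then have "2 * (i div p ^ e) < p" by simp
  moreover have "N \<le> k div p ^ e" using k Q by (simp add: less_eq_div_iff_mult_less_eq)
  ultimately have "N - a \<le> j div p ^ e"
    using no_carry_div[OF nc, of e] a by linarith
  then show ?thesis using Q by (simp add: less_eq_div_iff_mult_less_eq)
qed

section \<open>The ideals on each interval of exponents\<close>

context
  fixes p :: nat and I :: "'k::field poly3 set"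
  assumes p: "prime p" "CHAR('k) = p"
    and I: "I = ideal_gen {Var X ^ 2 * Var Y ^ 2, Var Y ^ 3 * Var Z ^ 3}"
begin

lemma p_gt_1: "p > 1"
  using p prime_gt_1_nat by blast

lemma gen_frob_power_UNIV: "\<forall>t\<in>{0..<1/2}. gen_frob_power p I t = UNIV"
proof -
  have "\<forall>t\<in>{0..<1/2}. gen_frob_power p I t = ideal_gen ((\<lambda>(r, s, t). xyz_monom r s t) ` {(0, 0, 0)})"
  proof (rule gen_frob_power_xyz[OF p I, where n = 0 and d = 1 and n' = 1 and d' = 2])
    fix k q e :: nat and r s t :: nat
    assume k: "q = p ^ e" "2 * k < 1 * q" and "(r, s, t) \<in> {(0, 0, 0)}"
    then show "\<exists>i j. no_carry p i j k \<and> 2 * i < (r + 1) * q \<and> 2 * i + 3 * j < (s + 1) * q \<and> 3 * j < (t + 1) * q"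
      using p_gt_1 by (intro exI[of _ k] exI[of _ "0 :: nat"]) auto
  qed auto
  then show ?thesis by (simp add: ideal_gen_1)
qed

text \<open>From k \<ge> q/2 follows 2i + 3j \<ge> q, so y divides every generator. Conversely i <
  q/2 and j < q/3 give 2i + 3j < 2q, hence exactly y.\<close>

lemma gen_frob_power_y:
  assumes "d > 0" "b = real n / real d"
    and lower: "\<And>k q e. q = p ^ e \<Longrightarrow> q \<le> 2 * k \<Longrightarrow> d * k < n * q \<Longrightarrow>
      \<exists>i j. no_carry p i j k \<and> 2 * i < q \<and> 3 * j < q"
  shows "\<forall>t\<in>{1/2..<b}. gen_frob_power p I t = ideal_gen {Var Y}"
proof -
  have "\<forall>t\<in>{1/2..<b}. gen_frob_power p I t = ideal_gen ((\<lambda>(r, s, t). xyz_monom r s t) ` {(0, 1, 0)})"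
  proof (rule gen_frob_power_xyz[OF p I _ assms(1) _ assms(2), where n = 1 and d = 2])
    fix k q e i j :: nat
    assume "no_carry p i j k" "1 * q \<le> 2 * k"
    then show "\<exists>(r, s, t) \<in> {(0, 1, 0)}. r * q \<le> 2 * i \<and> s * q \<le> 2 * i + 3 * j \<and> t * q \<le> 3 * j"
      using no_carry_sum by fastforce
  next
    fix k q e r s t :: nat
    assume "q = p ^ e" "1 * q \<le> 2 * k" "d * k < n * q" "(r, s, t) \<in> {(0, 1, 0)}"
    with lower[of q e k]
    show "\<exists>i j. no_carry p i j k \<and> 2 * i < (r + 1) * q \<and> 2 * i + 3 * j < (s + 1) * q \<and> 3 * j < (t + 1) * q"
      by fastforce
  qed auto
  then show ?thesis by simp
qed

text \<open>The interval lies within [1/2, 1). The power u^k always yields xy, so only pairs with 2i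
  < q matter: \<open>upper\<close> makes them multiples of yz, and \<open>lower\<close> realizes
  yz.\<close>

lemma gen_frob_power_xy_yz:
  assumes d: "d > 0" "d' > 0" "a = real n / real d" "b = real n' / real d'" "d \<le> 2 * n" "n' \<le> d'"
    and upper: "\<And>k q e i j. no_carry p i j k \<Longrightarrow> q = p ^ e \<Longrightarrow> n * q \<le> d * k \<Longrightarrow> k < q \<Longrightarrow>
      q \<le> 2 * k \<Longrightarrow> 2 * i < q \<Longrightarrow> q \<le> 3 * j"
    and lower: "\<And>k q e. q = p ^ e \<Longrightarrow> n * q \<le> d * k \<Longrightarrow> d' * k < n' * q \<Longrightarrow> k < q \<Longrightarrow> q \<le> 2 * k \<Longrightarrow>
      \<exists>i j. no_carry p i j k \<and> 2 * i < q \<and> 2 * i + 3 * j < 2 * q \<and> 3 * j < 2 * q"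
  shows "\<forall>t\<in>{a..<b}. gen_frob_power p I t = ideal_gen {Var X * Var Y, Var Y * Var Z}"
proof -
  have half: "q \<le> 2 * k" if "n * q \<le> d * k" for q k
  proof -
    have "d * q \<le> 2 * (n * q)" using d(5) mult_le_mono1[of d "2 * n" q] by simp
    also have "\<dots> \<le> d * (2 * k)" using that by simp
    finally show ?thesis using d(1) by simp
  qed
  have one: "k < q" if "d' * k < n' * q" for q k
  proof -
    have "n' * q \<le> d' * q" using d(6) by (rule mult_le_mono1)
    with that have "d' * k < d' * q" by linarith
    then show ?thesis by simp
  qed
  have "\<forall>t\<in>{a..<b}. gen_frob_power p I t =
    ideal_gen ((\<lambda>(r, s, t). xyz_monom r s t) ` {(1, 1, 0), (0, 1, 1)})"
  proof (rule gen_frob_power_xyz[OF p I d(1-4)])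
    fix k q e i j :: nat
    assume *: "no_carry p i j k" "q = p ^ e" "n * q \<le> d * k" "d' * k < n' * q"
    then show "\<exists>(r, s, t) \<in> {(1, 1, 0), (0, 1, 1)}.
        r * q \<le> 2 * i \<and> s * q \<le> 2 * i + 3 * j \<and> t * q \<le> 3 * j"
      using upper[OF *(1-3) one[OF *(4)] half[OF *(3)]] by (cases "2 * i < q") auto
  next
    fix k q e r s t :: nat
    assume *: "q = p ^ e" "n * q \<le> d * k" "d' * k < n' * q" and "(r, s, t) \<in> {(1, 1, 0), (0, 1, 1)}"
    then consider "r = 1" "s = 1" "t = 0" | "r = 0" "s = 1" "t = 1" by auto
    then show "\<exists>i j. no_carry p i j k \<and> 2 * i < (r + 1) * q \<and> 2 * i + 3 * j < (s + 1) * q \<and> 3 * j < (t + 1) * q"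
    proof cases
      case 1
      then show ?thesis
        using p_gt_1 one[OF *(3)] by (intro exI[of _ k] exI[of _ "0 :: nat"]) auto
    next
      case 2
      then show ?thesis
        using lower[OF * one[OF *(3)] half[OF *(2)]]
        unfolding 2 one_add_one add_0 mult_1 by blast
    qed
  qed
  then show ?thesis by simp
qed

text \<open>The generator y^2 z occurs for every k < q by \<open>no_carry_half_two_thirds\<close>.
  What depends on p is where all pairs with 2i < q become multiples of it.\<close>

lemma gen_frob_power_xy_y2z:
  assumes d: "d > 0" "a = real n / real d"
    and upper: "\<And>k q e i j. no_carry p i j k \<Longrightarrow> q = p ^ e \<Longrightarrow> n * q \<le> d * k \<Longrightarrow> k < q \<Longrightarrow> 2 * i < q \<Longrightarrow>
      q \<le> 3 * j \<and> 2 * q \<le> 2 * i + 3 * j"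
  shows "\<forall>t\<in>{a..<1}. gen_frob_power p I t = ideal_gen {Var X * Var Y, Var Y ^ 2 * Var Z}"
proof -
  have "\<forall>t\<in>{a..<1}. gen_frob_power p I t =
    ideal_gen ((\<lambda>(r, s, t). xyz_monom r s t) ` {(1, 1, 0), (0, 2, 1)})"
  proof (rule gen_frob_power_xyz[OF p I d(1) _ d(2), where n' = 1 and d' = 1])
    fix k q e i j :: nat
    assume *: "no_carry p i j k" "q = p ^ e" "n * q \<le> d * k" "1 * k < 1 * q"
    then show "\<exists>(r, s, t) \<in> {(1, 1, 0), (0, 2, 1)}.
        r * q \<le> 2 * i \<and> s * q \<le> 2 * i + 3 * j \<and> t * q \<le> 3 * j"
      using upper[OF *(1-3)] by (cases "2 * i < q") auto
  next
    fix k q e r s t :: nat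
    assume *: "q = p ^ e" "1 * k < 1 * q" and "(r, s, t) \<in> {(1, 1, 0), (0, 2, 1)}"
    then consider "r = 1" "s = 1" "t = 0" | "r = 0" "s = 2" "t = 1" by auto
    then show "\<exists>i j. no_carry p i j k \<and> 2 * i < (r + 1) * q \<and> 2 * i + 3 * j < (s + 1) * q \<and> 3 * j < (t + 1) * q"
    proof cases
      case 1
      then show ?thesis
        using p_gt_1 * by (intro exI[of _ k] exI[of _ "0 :: nat"]) auto
    next
      case 2
      have "k < p ^ e" using * by simp
      from no_carry_half_two_thirds[OF p(1) this] 2 * show ?thesis by fastforce
    qed
  qed auto
  then show ?thesis by simp
qed

text \<open>Only i + j = k is used: 2i < q and k \<ge> 5q/6 give j > q/3 and 2i + 3j = 3k - i >
  2q.\<close>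

lemma gen_frob_power_five_sixths:
  "\<forall>t\<in>{5/6..<1}. gen_frob_power p I t = ideal_gen {Var X * Var Y, Var Y ^ 2 * Var Z}"
proof (rule gen_frob_power_xy_y2z[where n = 5 and d = 6])
  fix k q e i j :: nat
  assume "no_carry p i j k" "5 * q \<le> 6 * k" "2 * i < q"
  then show "q \<le> 3 * j \<and> 2 * q \<le> 2 * i + 3 * j"
    using no_carry_sum[of p i j k] by linarith
qed auto

lemma gen_frob_power_p2:
  assumes p2: "p = 2"
  shows "\<forall>t\<in>{1/2..<3/4}. gen_frob_power p I t = ideal_gen {Var X * Var Y, Var Y * Var Z}"
    and "\<forall>t\<in>{3/4..<1}. gen_frob_power p I t = ideal_gen {Var X * Var Y, Var Y ^ 2 * Var Z}"
proof -
  \<comment> \<open>In base 2 the leading digit of k is 1 and that of i is 0, so j \<ge> q/2. Thus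
    2i + 3j = 2k + j is at least 2k + q/2, which reaches 2q at k = 3q/4.\<close>
  have top: "\<exists>Q. q = 2 * Q \<and> Q \<le> j"
    if "no_carry p i j k" "q = p ^ e" "k < q" "q \<le> 2 * k" "2 * i < q" for k q e i j
  proof -
    have "p ^ e \<le> 2 * k" "k < p ^ e" using that by simp_all
    then obtain e' where e: "e = Suc e'"
      using split_top_digit_half by blast
    have "(1 - 0) * p ^ e' \<le> j"
      using that e p2 by (intro no_carry_digit_ge[of p i j k]) auto
    then show ?thesis using that e p2 by simp
  qed
  show "\<forall>t\<in>{1/2..<3/4}. gen_frob_power p I t = ideal_gen {Var X * Var Y, Var Y * Var Z}"
  proof (rule gen_frob_power_xy_yz[where n = 1 and d = 2 and n' = 3 and d' = 4])
    fix k q e i j :: nat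
    assume "no_carry p i j k" "q = p ^ e" "k < q" "q \<le> 2 * k" "2 * i < q"
    from top[OF this] show "q \<le> 3 * j" by auto
  next
    fix k q e :: nat
    assume *: "q = p ^ e" "4 * k < 3 * q" "k < q" "q \<le> 2 * k"
    then have "p ^ e \<le> 2 * k" "k < p ^ e" by simp_all
    from split_top_digit_half[OF this] obtain e' c r
      where e: "e = Suc e'" "k = r + c * p ^ e'" "r < p ^ e'" "c < p" .
    have c: "c = 1"
    proof (rule ccontr)
      assume "c \<noteq> 1"
      then have "c = 0" using e p2 by simp
      then show False using e * p2 by simp
    qed
    have "no_carry p (r + 0 * p ^ e') (0 + 1 * p ^ e') (r + (0 + 1) * p ^ e')"
      by (rule no_carry_top) (use e p_gt_1 in auto)
    then show "\<exists>i j. no_carry p i j k \<and> 2 * i < q \<and> 2 * i + 3 * j < 2 * q \<and> 3 * j < 2 * q"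
      using e * c p2 by (intro exI[of _ r] exI[of _ "p ^ e'"]) auto
  qed auto
  show "\<forall>t\<in>{3/4..<1}. gen_frob_power p I t = ideal_gen {Var X * Var Y, Var Y ^ 2 * Var Z}"
  proof (rule gen_frob_power_xy_y2z[where n = 3 and d = 4])
    fix k q e i j :: nat
    assume *: "no_carry p i j k" "q = p ^ e" "3 * q \<le> 4 * k" "k < q" "2 * i < q"
    then have "q \<le> 2 * k" by simp
    from top[OF *(1,2,4) this *(5)] * no_carry_sum[OF *(1)]
    show "q \<le> 3 * j \<and> 2 * q \<le> 2 * i + 3 * j" by auto
  qed auto
qed

lemma gen_frob_power_p3:
  assumes p3: "p = 3"
  shows "\<forall>t\<in>{1/2..<2/3}. gen_frob_power p I t = ideal_gen {Var Y}"
    and "\<forall>t\<in>{2/3..<5/6}. gen_frob_power p I t = ideal_gen {Var X * Var Y, Var Y * Var Z}"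
proof -
  show "\<forall>t\<in>{1/2..<2/3}. gen_frob_power p I t = ideal_gen {Var Y}"
  proof (rule gen_frob_power_y[where n = 2 and d = 3])
    fix k q e :: nat
    assume *: "q = p ^ e" "q \<le> 2 * k" "3 * k < 2 * q"
    then have "p ^ e \<le> 2 * k" "k < p ^ e" by simp_all
    from split_top_digit_half[OF this] obtain e' c r
      where e: "e = Suc e'" "k = r + c * p ^ e'" "r < p ^ e'" "c < p" .
    have c: "c = 1"
    proof (rule ccontr)
      assume "c \<noteq> 1"
      then have "c = 0 \<or> c = 2" using e p3 by linarith
      then show False using e * p3 by auto
    qed
    \<comment> \<open>Leading digit 1: i = q/3 is below q/2, and j = r is below q/3.\<close>
    have "no_carry p (0 + 1 * p ^ e') (r + 0 * p ^ e') (r + (1 + 0) * p ^ e')"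
      by (rule no_carry_top) (use e p_gt_1 in auto)
    then show "\<exists>i j. no_carry p i j k \<and> 2 * i < q \<and> 3 * j < q"
      using e * c p3 by (intro exI[of _ "p ^ e'"] exI[of _ r]) auto
  qed auto
  show "\<forall>t\<in>{2/3..<5/6}. gen_frob_power p I t = ideal_gen {Var X * Var Y, Var Y * Var Z}"
  proof (rule gen_frob_power_xy_yz[where n = 2 and d = 3 and n' = 5 and d' = 6])
    fix k q e i j :: nat
    assume *: "no_carry p i j k" "q = p ^ e" "2 * q \<le> 3 * k" "k < q" "q \<le> 2 * k" "2 * i < q"
    then have "p ^ e \<le> 2 * k" "k < p ^ e" by simp_all
    then obtain e' where e: "e = Suc e'"
      using split_top_digit_half by blast
    \<comment> \<open>The leading digit of k is 2 and that of i is at most 1, so j \<ge>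
      q/3.\<close>
    have "(2 - 1) * p ^ e' \<le> j"
      using * e p3 by (intro no_carry_digit_ge[of p i j k]) auto
    then show "q \<le> 3 * j" using * e p3 by simp
  next
    fix k q e :: nat
    assume *: "q = p ^ e" "2 * q \<le> 3 * k" "6 * k < 5 * q" "k < q" "q \<le> 2 * k"
    then have "p ^ e \<le> 2 * k" "k < p ^ e" by simp_all
    from split_top_digit_half[OF this] obtain e' c r
      where e: "e = Suc e'" "k = r + c * p ^ e'" "r < p ^ e'" "c < p" .
    have c: "c = 2"
    proof (rule ccontr)
      assume "c \<noteq> 2"
      then have "c = 0 \<or> c = 1" using e p3 by linarith
      then show False using e * p3 by auto
    qed
    \<comment> \<open>Split the leading digit 2 evenly. Then j = q/3 and i = k - q/3, which is below
      q/2 exactly because k < 5q/6.\<close>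
    have "no_carry p (r + 1 * p ^ e') (0 + 1 * p ^ e') (r + (1 + 1) * p ^ e')"
      by (rule no_carry_top) (use e p3 in auto)
    then have "no_carry p (r + p ^ e') (p ^ e') k"
      unfolding e(2) c one_add_one mult_1 add_0 .
    moreover have "2 * (r + p ^ e') < q" "2 * (r + p ^ e') + 3 * p ^ e' < 2 * q" "3 * p ^ e' < 2 * q"
      using * e c p3 by auto
    ultimately show "\<exists>i j. no_carry p i j k \<and> 2 * i < q \<and> 2 * i + 3 * j < 2 * q \<and> 3 * j < 2 * q"
      by blast
  qed auto
qed

lemma gen_frob_power_p_mod_1:
  assumes "p mod 3 = 1"
  shows "\<forall>t\<in>{1/2..<5/6}. gen_frob_power p I t = ideal_gen {Var Y}"
proof (rule gen_frob_power_y[where n = 5 and d = 6])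
  have "odd p" using p(1) assms prime_odd_nat[of p] p_gt_1 by (cases "p = 2") auto
  then have "p = 6 * (p div 6) + 1" using assms by presburger
  moreover from this have "p div 6 > 0" using p_gt_1 by linarith
  ultimately show "\<exists>i j. no_carry p i j k \<and> 2 * i < q \<and> 3 * j < q"
    if "q = p ^ e" "6 * k < 5 * q" for k q e
    using no_carry_half_third that by blast
qed auto

lemma gen_frob_power_p_mod_2:
  assumes "p mod 3 = 2" "p \<noteq> 2"
  shows "\<forall>t\<in>{1/2..<(5 * real p - 1) / (6 * real p)}. gen_frob_power p I t = ideal_gen {Var Y}"
    and "\<forall>t\<in>{(5 * real p - 1) / (6 * real p)..<1}.
      gen_frob_power p I t = ideal_gen {Var X * Var Y, Var Y ^ 2 * Var Z}"
proof -
  have "odd p" using p(1) assms prime_odd_nat[of p] p_gt_1 by auto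
  define n where "n = p div 6"
  have pn: "p = 6 * n + 5" using assms \<open>odd p\<close> unfolding n_def by presburger
  \<comment> \<open>With p = 6n + 5 the endpoint has denominator p: it is decided by the leading
    digit alone.\<close>
  have b: "(5 * real p - 1) / (6 * real p) = real (5 * n + 4) / real p"
    unfolding pn by (simp add: field_simps)
  show "\<forall>t\<in>{1/2..<(5 * real p - 1) / (6 * real p)}. gen_frob_power p I t = ideal_gen {Var Y}"
    by (rule gen_frob_power_y[OF _ b])
      (use p_gt_1 no_carry_half_third'[OF p(1) pn] in auto)
  show "\<forall>t\<in>{(5 * real p - 1) / (6 * real p)..<1}.
      gen_frob_power p I t = ideal_gen {Var X * Var Y, Var Y ^ 2 * Var Z}"
  proof (rule gen_frob_power_xy_y2z[OF _ b])
    fix k q e i j :: nat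
    assume *: "no_carry p i j k" "q = p ^ e" "(5 * n + 4) * q \<le> p * k" "k < q" "2 * i < q"
    have "p * q \<le> 2 * ((5 * n + 4) * q)"
      using mult_le_mono1[of p "2 * (5 * n + 4)" q] pn by simp
    also have "\<dots> \<le> p * (2 * k)" using *(3) by simp
    finally have "q \<le> 2 * k" using p_gt_1 by simp
    then have "p ^ e \<le> 2 * k" "k < p ^ e" using * by simp_all
    then obtain e' where e: "e = Suc e'"
      using split_top_digit_half by blast
    define Q where "Q = p ^ e'"
    have q: "q = p * Q" using * e by (simp add: Q_def)
    have "p * ((5 * n + 4) * Q) \<le> p * k" using *(3) q by (simp add: mult_ac)
    then have k: "(5 * n + 4) * Q \<le> k" using p_gt_1 by simp
    \<comment> \<open>The leading digit of i is at most 3n + 2. The resulting bound is just enough: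
      2i + 3j = 2k + j \<ge> (12n + 10) Q = 2q.\<close>
    have "(5 * n + 4 - (3 * n + 2)) * Q \<le> j"
      using * q k p_gt_1 unfolding Q_def
      by (intro no_carry_digit_ge[of p i j k]) (simp_all add: pn)
    then have j: "(2 * n + 2) * Q \<le> j" by simp
    show "q \<le> 3 * j \<and> 2 * q \<le> 2 * i + 3 * j"
      using j k no_carry_sum[OF *(1)] unfolding q pn by (simp add: algebra_simps)
  qed (use p_gt_1 in simp)
qed

end

theorem proposition4p2:
  fixes p :: nat
    and x y z :: "'k::field poly3"
    and I :: "'k poly3 set"
  assumes "prime p" and "CHAR('k) = p" and "F_finite TYPE('k)"
    and "x = Var X" and "y = Var Y" and "z = Var Z"
    and "I = ideal_gen {x ^ 2 * y ^ 2, y ^ 3 * z ^ 3}"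
  shows
    "(p = 2 \<longrightarrow>
        (\<forall>t\<in>{0..<1/2}. gen_frob_power p I t = UNIV) \<and>
        (\<forall>t\<in>{1/2..<3/4}. gen_frob_power p I t = ideal_gen {x * y, y * z}) \<and>
        (\<forall>t\<in>{3/4..<1}. gen_frob_power p I t = ideal_gen {x * y, y ^ 2 * z})) \<and>
     (p = 3 \<longrightarrow>
        (\<forall>t\<in>{0..<1/2}. gen_frob_power p I t = UNIV) \<and>
        (\<forall>t\<in>{1/2..<2/3}. gen_frob_power p I t = ideal_gen {y}) \<and>
        (\<forall>t\<in>{2/3..<5/6}. gen_frob_power p I t = ideal_gen {x * y, y * z}) \<and>
        (\<forall>t\<in>{5/6..<1}. gen_frob_power p I t = ideal_gen {x * y, y ^ 2 * z})) \<and>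
     (p mod 3 = 1 \<longrightarrow>
        (\<forall>t\<in>{0..<1/2}. gen_frob_power p I t = UNIV) \<and>
        (\<forall>t\<in>{1/2..<5/6}. gen_frob_power p I t = ideal_gen {y}) \<and>
        (\<forall>t\<in>{5/6..<1}. gen_frob_power p I t = ideal_gen {x * y, y ^ 2 * z})) \<and>
     (p mod 3 = 2 \<and> p \<noteq> 2 \<longrightarrow>
        (\<forall>t\<in>{0..<1/2}. gen_frob_power p I t = UNIV) \<and>
        (\<forall>t\<in>{1/2..<(5 * real p - 1) / (6 * real p)}. gen_frob_power p I t = ideal_gen {y}) \<and>
        (\<forall>t\<in>{(5 * real p - 1) / (6 * real p)..<1}.
            gen_frob_power p I t = ideal_gen {x * y, y ^ 2 * z}))"
proof -
  note I = assms(7)[unfolded assms(4-6)]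
  note p = assms(1,2)
  show ?thesis
    unfolding assms(4-6)
    by (intro conjI impI gen_frob_power_UNIV[OF p I] gen_frob_power_five_sixths[OF p I]
        gen_frob_power_p2[OF p I] gen_frob_power_p3[OF p I] gen_frob_power_p_mod_1[OF p I]
        gen_frob_power_p_mod_2[OF p I]) simp_all
qed

end
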